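(* Let $k$ be a commutative ring with unit. For each inclusion of categories $\mathrm{FI}_{\mathcal{W}}\subseteq\mathrm{FI}_{\overline{\mathcal{W}}}$ among $\mathrm{FI}_A\subset\mathrm{FI}_D\subset\mathrm{FI}_{BC}$, the restriction $\mathrm{Res}_{\mathcal{W}}^{\overline{\mathcal{W}}}V$ of a finitely generated $\mathrm{FI}_{\overline{\mathcal{W}}}$-module $V$ over $k$ is finitely generated as an $\mathrm{FI}_{\mathcal{W}}$-module. Specifically: (1) If $V$ is an $\mathrm{FI}_{BC}$-module finitely generated in degree $\le m$, then $\mathrm{Res}^{BC}_AV$ is finitely generated as an $\mathrm{FI}_A$-module in degree $\le m$. (2) If $V$ is an $\mathrm{FI}_{BC}$-module finitely generated in degree $\le m$, then $\mathrm{Res}^{BC}_DV$ is finitely generated as an $\mathrm{FI}_D$-module in degree $\le m$. (3) If $V$ is an $\mathrm{FI}_D$-module finitely generated in degree $\le m$, then $\mathrm{Res}^{D}_AV$ is finitely generated as an $\mathrm{FI}_A$-module in degree $\le m+1$.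
   Context: For $n\ge 0$ let $\mathbf{n}=\{\pm1,\dots,\pm n\}$, $\mathbf{0}=\varnothing$. $\mathrm{FI}_{BC}$ is the category with objects $\mathbf{n}$ and morphisms the injections $f:\mathbf{m}\to\mathbf{n}$ with $f(-a)=-f(a)$. $\mathrm{FI}_D$ is the subcategory with the same objects and the same morphisms except that an isomorphism must reverse an even number of signs. $\mathrm{FI}_A$ is the subcategory with the same objects and only the sign-preserving morphisms. An $\mathrm{FI}_{\mathcal{W}}$-module over $k$ is a functor $V:\mathrm{FI}_{\mathcal{W}}\to k\text{-Mod}$, $V_n:=V(\mathbf{n})$. It is finitely generated in degree $\le m$ if there is a finite set of elements $v_i\in V_{m_i}$, $m_i\le m$, contained in no proper sub-$\mathrm{FI}_{\mathcal{W}}$-module. $\mathrm{Res}_{\mathcal{W}}^{\overline{\mathcal{W}}}V$ is the composite of the functor $V$ with the inclusion $\mathrm{FI}_{\mathcal{W}}\hookrightarrow\mathrm{FI}_{\overline{\mathcal{W}}}$. *)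

theory Defs
  imports "HOL-Algebra.Module" "HOL-Library.FuncSet"
begin

definition pm :: "nat \<Rightarrow> int set" where
  "pm n = {x. x \<noteq> 0 \<and> \<bar>x\<bar> \<le> int n}"

text \<open>
  The categories have the natural numbers as objects (\<open>n\<close> stands for \<^term>\<open>pm n\<close>), so each is
  given by its family of Hom-sets \<open>W m n\<close>. Morphisms are extensional functions, so that equality
  of morphisms is equality of functions; identity and composition are
  \<^term>\<open>\<lambda>x\<in>pm n. x\<close> and \<^term>\<open>compose (pm l) g f\<close> in all of them.
\<close>

type_synonym hom_sets = "nat \<Rightarrow> nat \<Rightarrow> (int \<Rightarrow> int) set"

definition FI_BC :: hom_sets where
  "FI_BC m n = {f \<in> pm m \<rightarrow>\<^sub>E pm n. inj_on f (pm m) \<and> (\<forall>a\<in>pm m. f (- a) = - f a)}"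

definition FI_BC_iso :: "nat \<Rightarrow> nat \<Rightarrow> (int \<Rightarrow> int) \<Rightarrow> bool" where
  "FI_BC_iso m n f \<longleftrightarrow> f \<in> FI_BC m n \<and>
     (\<exists>g\<in>FI_BC n m. compose (pm m) g f = (\<lambda>x\<in>pm m. x) \<and> compose (pm n) f g = (\<lambda>x\<in>pm n. x))"

definition FI_D :: hom_sets where
  "FI_D m n = {f \<in> FI_BC m n. FI_BC_iso m n f \<longrightarrow> even (card {a \<in> {1..int m}. f a < 0})}"

definition FI_A :: hom_sets where
  "FI_A m n = {f \<in> FI_BC m n. \<forall>a\<in>pm m. sgn (f a) = sgn a}"

definition linear_maps ::
  "('a, 'r) ring_scheme \<Rightarrow> ('a, 'b) module \<Rightarrow> ('a, 'b) module \<Rightarrow> ('b \<Rightarrow> 'b) set" where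
  "linear_maps R M N = {\<phi> \<in> hom (add_monoid M) (add_monoid N).
     \<forall>c\<in>carrier R. \<forall>x\<in>carrier M. \<phi> (c \<odot>\<^bsub>M\<^esub> x) = c \<odot>\<^bsub>N\<^esub> \<phi> x}"

text \<open>
  \<open>mor V m n f\<close> is the map from \<open>obj V m\<close> to \<open>obj V n\<close> induced by \<open>f : m \<rightarrow> n\<close>. The target \<open>n\<close> is
  an argument because an extensional function does not determine its codomain.
\<close>

record ('a, 'b) functor_data =
  obj :: "nat \<Rightarrow> ('a, 'b) module"
  mor :: "nat \<Rightarrow> nat \<Rightarrow> (int \<Rightarrow> int) \<Rightarrow> 'b \<Rightarrow> 'b"

definition FI_module :: "hom_sets \<Rightarrow> ('a, 'r) ring_scheme \<Rightarrow> ('a, 'b) functor_data \<Rightarrow> bool" where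
  "FI_module W R V \<longleftrightarrow>
     (\<forall>n. module R (obj V n)) \<and>
     (\<forall>m n. \<forall>f\<in>W m n. mor V m n f \<in> linear_maps R (obj V m) (obj V n)) \<and>
     (\<forall>n. \<forall>x\<in>carrier (obj V n). mor V n n (\<lambda>a\<in>pm n. a) x = x) \<and>
     (\<forall>l m n. \<forall>f\<in>W l m. \<forall>g\<in>W m n. \<forall>x\<in>carrier (obj V l).
        mor V l n (compose (pm l) g f) x = mor V m n g (mor V l m f x))"

definition sub_FI_module ::
  "hom_sets \<Rightarrow> ('a, 'r) ring_scheme \<Rightarrow> ('a, 'b) functor_data \<Rightarrow> (nat \<Rightarrow> 'b set) \<Rightarrow> bool" where
  "sub_FI_module W R V U \<longleftrightarrow>
     (\<forall>n. submodule (U n) R (obj V n)) \<and>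
     (\<forall>m n. \<forall>f\<in>W m n. mor V m n f ` U m \<subseteq> U n)"

text \<open>A set \<open>S\<close> of elements of \<open>V\<close> consists of pairs \<open>(d, v)\<close> with \<open>v\<close> in \<open>obj V d\<close>.\<close>

definition generates ::
  "hom_sets \<Rightarrow> ('a, 'r) ring_scheme \<Rightarrow> ('a, 'b) functor_data \<Rightarrow> (nat \<times> 'b) set \<Rightarrow> bool" where
  "generates W R V S \<longleftrightarrow>
     (\<forall>(d, v)\<in>S. v \<in> carrier (obj V d)) \<and>
     (\<forall>U. sub_FI_module W R V U \<longrightarrow> (\<forall>(d, v)\<in>S. v \<in> U d) \<longrightarrow> (\<forall>n. U n = carrier (obj V n)))"

definition finitely_generated ::
  "hom_sets \<Rightarrow> ('a, 'r) ring_scheme \<Rightarrow> ('a, 'b) functor_data \<Rightarrow> bool" where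
  "finitely_generated W R V \<longleftrightarrow> FI_module W R V \<and> (\<exists>S. finite S \<and> generates W R V S)"

definition finitely_generated_in_degree ::
  "hom_sets \<Rightarrow> ('a, 'r) ring_scheme \<Rightarrow> ('a, 'b) functor_data \<Rightarrow> nat \<Rightarrow> bool" where
  "finitely_generated_in_degree W R V m \<longleftrightarrow> FI_module W R V \<and>
     (\<exists>S. finite S \<and> (\<forall>(d, v)\<in>S. d \<le> m) \<and> generates W R V S)"

text \<open>
  Precomposition with the inclusion of the subcategory with Hom-sets \<open>W\<close>, which is the identity
  on objects and on the morphisms in \<open>W\<close>.
\<close>

definition Res :: "hom_sets \<Rightarrow> ('a, 'b) functor_data \<Rightarrow> ('a, 'b) functor_data" where
  "Res W V = \<lparr>obj = obj V, mor = (\<lambda>m n. restrict (mor V m n) (W m n))\<rparr>"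

lemma FI_D_le_FI_BC: "FI_D \<le> FI_BC"
  by (auto simp: le_fun_def FI_D_def)

lemma FI_A_le_FI_D: "FI_A \<le> FI_D"
proof -
  have "f \<in> FI_D m n" if f: "f \<in> FI_A m n" for m n f
  proof -
    have "\<not> f a < 0" if "a \<in> {1..int m}" for a
    proof -
      have "a \<in> pm m" "sgn a = 1" using that by (auto simp: pm_def)
      then have "sgn (f a) = 1" using f by (simp add: FI_A_def)
      then show ?thesis by auto
    qed
    then have "{a \<in> {1..int m}. f a < 0} = {}" by blast
    then have "even (card {a \<in> {1..int m}. f a < 0})" by (metis card.empty even_zero)
    then show ?thesis using f by (simp add: FI_A_def FI_D_def)
  qed
  then show ?thesis by (auto simp: le_fun_def)
qed

end

theory Submission
  imports Defs
begin

text \<open>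
  Suppose every morphism \<open>f\<close> of \<open>W'\<close> out of \<open>d\<close> factors as \<open>g \<circ> h\<close> with \<open>h \<in> W' d e\<close>,
  \<open>g \<in> W e n\<close> and \<open>e \<le> d + r\<close>. Then the images of a generating set under the finitely many such
  \<open>h\<close> generate the restriction to \<open>W\<close>: if a sub-\<open>W\<close>-module \<open>U\<close> contains them, then the largest
  sub-\<open>W'\<close>-module contained in \<open>U\<close> contains the original generators, so it is everything.
  Splitting off the signs of \<open>f\<close> gives such a factorization through \<open>e = d\<close> for \<open>FI_BC\<close>. For
  \<open>FI_D\<close> the sign change may be odd when \<open>d < n\<close>; one then factors through \<open>e = d + 1\<close>, since
  \<open>FI_D\<close> restricts the signs of isomorphisms only.
\<close>

section \<open>Categories of signed injections\<close>

lemma finite_pm [simp]: "finite (pm n)"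
proof -
  have "pm n \<subseteq> {- int n..int n}" by (auto simp: pm_def)
  then show ?thesis by (rule finite_subset) simp
qed

lemma uminus_in_pm_iff [simp]: "- a \<in> pm n \<longleftrightarrow> a \<in> pm n"
  by (auto simp: pm_def)

lemma abs_in_pm_iff [simp]: "\<bar>a\<bar> \<in> pm n \<longleftrightarrow> a \<in> pm n"
  by (auto simp: pm_def)

lemma pm_mono: "m \<le> n \<Longrightarrow> pm m \<subseteq> pm n"
  by (auto simp: pm_def)

lemma in_pm_if_in_Icc: "a \<in> {1..int n} \<Longrightarrow> a \<in> pm n"
  by (auto simp: pm_def)

lemma abs_in_Icc_if_in_pm: "a \<in> pm n \<Longrightarrow> \<bar>a\<bar> \<in> {1..int n}"
  by (auto simp: pm_def)

section \<open>Signed injections and the maps they induce on absolute values\<close>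

lemma FI_BC_maps: "f \<in> FI_BC m n \<Longrightarrow> a \<in> pm m \<Longrightarrow> f a \<in> pm n"
  by (auto simp: FI_BC_def PiE_iff)

lemma FI_BC_nonzero: "f \<in> FI_BC m n \<Longrightarrow> a \<in> pm m \<Longrightarrow> f a \<noteq> 0"
  using FI_BC_maps by (fastforce simp: pm_def)

lemma FI_BC_odd: "f \<in> FI_BC m n \<Longrightarrow> a \<in> pm m \<Longrightarrow> f (- a) = - f a"
  by (auto simp: FI_BC_def)

lemma FI_BC_inj: "f \<in> FI_BC m n \<Longrightarrow> inj_on f (pm m)"
  by (auto simp: FI_BC_def)

lemma FI_BC_eq_iff: "f \<in> FI_BC m n \<Longrightarrow> a \<in> pm m \<Longrightarrow> b \<in> pm m \<Longrightarrow> f a = f b \<longleftrightarrow> a = b"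
  using FI_BC_inj inj_on_eq_iff by metis

lemma FI_BC_abs_arg: "f \<in> FI_BC m n \<Longrightarrow> a \<in> pm m \<Longrightarrow> f \<bar>a\<bar> = sgn a * f a"
  using FI_BC_odd[of f m n a] FI_BC_nonzero[of f m n a] by (auto simp: abs_if sgn_if pm_def)

lemma FI_BC_abs_eq_iff:
  assumes "f \<in> FI_BC m n" "a \<in> pm m" "b \<in> pm m"
  shows "\<bar>f a\<bar> = \<bar>f b\<bar> \<longleftrightarrow> \<bar>a\<bar> = \<bar>b\<bar>"
proof -
  have "f a = - f b \<longleftrightarrow> a = - b"
    using FI_BC_eq_iff[OF assms(1,2), of "- b"] FI_BC_odd[OF assms(1,3)] assms(3) by simp
  then show ?thesis
    using FI_BC_eq_iff[OF assms] by (simp add: abs_eq_iff)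
qed

lemma finite_FI_BC: "finite (FI_BC m n)"
  by (rule finite_subset[of _ "pm m \<rightarrow>\<^sub>E pm n"]) (auto simp: FI_BC_def intro: finite_PiE)

text \<open>Oddness lets \<open>f\<close> descend to an ordinary injection of the absolute values.
  All counting arguments are made for this map, on \<open>{1..int m}\<close> rather than on
  \<open>pm m\<close>.\<close>

lemma FI_BC_abs_inj:
  assumes "f \<in> FI_BC m n"
  shows "inj_on (\<lambda>a. \<bar>f a\<bar>) {1..int m}"
  using FI_BC_abs_eq_iff[OF assms in_pm_if_in_Icc in_pm_if_in_Icc] by (auto simp: inj_on_def)

lemma FI_BC_abs_image:
  assumes "f \<in> FI_BC m n"
  shows "(\<lambda>a. \<bar>f a\<bar>) ` {1..int m} \<subseteq> {1..int n}"
  using FI_BC_maps[OF assms] abs_in_Icc_if_in_pm in_pm_if_in_Icc by blast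

lemma FI_BC_le: "f \<in> FI_BC m n \<Longrightarrow> m \<le> n"
  using card_inj_on_le[OF FI_BC_abs_inj FI_BC_abs_image] by fastforce

lemma FI_BC_abs_bij: "f \<in> FI_BC n n \<Longrightarrow> bij_betw (\<lambda>a. \<bar>f a\<bar>) {1..int n} {1..int n}"
  unfolding bij_betw_def
  using FI_BC_abs_inj FI_BC_abs_image by (simp add: endo_inj_surj)

text \<open>An injective self-map of a finite set is bijective, and the inverse of an odd bijection
  is odd. Conversely, injections both ways force \<open>m = n\<close>. So the sign condition in
  \<open>FI_D\<close> constrains exactly the endomorphisms.\<close>

lemma FI_BC_iso_iff: "FI_BC_iso m n f \<longleftrightarrow> f \<in> FI_BC m n \<and> m = n"
proof
  assume "FI_BC_iso m n f"
  then obtain g where "f \<in> FI_BC m n" "g \<in> FI_BC n m"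
    by (auto simp: FI_BC_iso_def)
  then show "f \<in> FI_BC m n \<and> m = n"
    using FI_BC_le[of f m n] FI_BC_le[of g n m] by auto
next
  assume "f \<in> FI_BC m n \<and> m = n"
  then have f: "f \<in> FI_BC n n" and [simp]: "m = n" by auto
  have "f ` pm n = pm n"
    using FI_BC_maps[OF f] FI_BC_inj[OF f] by (intro endo_inj_surj) auto
  then have bij: "bij_betw f (pm n) (pm n)"
    using FI_BC_inj[OF f] by (simp add: bij_betw_def)
  define g where "g = restrict (inv_into (pm n) f) (pm n)"
  have g_maps: "g b \<in> pm n" and fg: "f (g b) = b" if "b \<in> pm n" for b
    using bij that by (auto simp: g_def bij_betw_def inv_into_into f_inv_into_f)
  have gf: "g (f a) = a" if "a \<in> pm n" for a
    using FI_BC_maps[OF f that] FI_BC_inj[OF f] that by (simp add: g_def)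
  \<comment> \<open>Apply \<open>g\<close> after \<open>f\<close> to \<open>- g b\<close>: by
    oddness \<open>f\<close> sends it to \<open>- b\<close>.\<close>
  have "g (- b) = - g b" if "b \<in> pm n" for b
    using gf[of "- g b"] FI_BC_odd[OF f g_maps[OF that]] fg[OF that] g_maps[OF that] by simp
  moreover have "inj_on g (pm n)"
    by (metis fg inj_onI)
  ultimately have "g \<in> FI_BC n n"
    using g_maps by (auto simp: FI_BC_def g_def)
  moreover have "compose (pm n) g f = (\<lambda>x\<in>pm n. x)" "compose (pm n) f g = (\<lambda>x\<in>pm n. x)"
    using gf fg by (auto simp: compose_def)
  ultimately show "FI_BC_iso m n f"
    using f by (auto simp: FI_BC_iso_def)
qed

section \<open>The three families of Hom-sets as subcategories\<close>

locale FI_category =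
  fixes W :: hom_sets
  assumes le_FI_BC: "W \<le> FI_BC"
    and id_mem: "(\<lambda>a\<in>pm n. a) \<in> W n n"
    and compose_mem: "f \<in> W l m \<Longrightarrow> g \<in> W m n \<Longrightarrow> compose (pm l) g f \<in> W l n"
begin

lemma finite_hom: "finite (W m n)"
  using le_FI_BC by (auto simp: le_fun_def intro: finite_subset[OF _ finite_FI_BC])

lemma mem_FI_BC: "f \<in> W m n \<Longrightarrow> f \<in> FI_BC m n"
  using le_FI_BC by (auto simp: le_fun_def)

end

lemma FI_category_BC: "FI_category FI_BC"
proof
  show "(\<lambda>a\<in>pm n. a) \<in> FI_BC n n" for n
    by (auto simp: FI_BC_def)
  fix l m n f g assume f: "f \<in> FI_BC l m" and g: "g \<in> FI_BC m n"
  have "inj_on (compose (pm l) g f) (pm l)"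
    using FI_BC_eq_iff[OF f] FI_BC_eq_iff[OF g] FI_BC_maps[OF f]
    by (auto simp: inj_on_def compose_def)
  then show "compose (pm l) g f \<in> FI_BC l n"
    using FI_BC_maps[OF f] FI_BC_maps[OF g] FI_BC_odd[OF f] FI_BC_odd[OF g]
    by (auto simp: FI_BC_def compose_def)
qed simp

lemma FI_category_A: "FI_category FI_A"
proof
  show "FI_A \<le> FI_BC"
    by (auto simp: le_fun_def FI_A_def)
  show "(\<lambda>a\<in>pm n. a) \<in> FI_A n n" for n
    using FI_category.id_mem[OF FI_category_BC] by (auto simp: FI_A_def)
  show "compose (pm l) g f \<in> FI_A l n" if "f \<in> FI_A l m" "g \<in> FI_A m n" for l m n f g
    using that FI_category.compose_mem[OF FI_category_BC] FI_BC_maps[of f l m]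
    by (auto simp: FI_A_def compose_def)
qed

lemma prod_sgn_eq:
  fixes f :: "int \<Rightarrow> int"
  assumes "finite A" "\<And>a. a \<in> A \<Longrightarrow> f a \<noteq> 0"
  shows "(\<Prod>a\<in>A. sgn (f a)) = (- 1) ^ card {a \<in> A. f a < 0}"
  using assms
proof induction
  case (insert x A)
  have "{a \<in> insert x A. f a < 0} =
      (if f x < 0 then insert x {a \<in> A. f a < 0} else {a \<in> A. f a < 0})"
    by auto
  then show ?case
    using insert by (auto simp: sgn_if)
qed auto

text \<open>A product of signs replaces the parity of a cardinality because it is multiplicative
  under composition, and it makes the restriction to \<open>m = n\<close> explicit.\<close>

lemma FI_D_iff_prod_sgn:
  "f \<in> FI_D m n \<longleftrightarrow> f \<in> FI_BC m n \<and> (m = n \<longrightarrow> (\<Prod>a = 1..int m. sgn (f a)) = 1)"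
proof (cases "f \<in> FI_BC m n")
  case True
  then have "(\<Prod>a = 1..int m. sgn (f a)) = (- 1) ^ card {a \<in> {1..int m}. f a < 0}"
    using FI_BC_nonzero in_pm_if_in_Icc by (intro prod_sgn_eq) blast+
  then have "(\<Prod>a = 1..int m. sgn (f a)) = 1 \<longleftrightarrow> even (card {a \<in> {1..int m}. f a < 0})"
    by (simp only: minus_one_power_iff split: if_split) simp
  then show ?thesis
    using True unfolding FI_D_def FI_BC_iso_iff by blast
qed (simp add: FI_D_def)

text \<open>The sign product is a homomorphism from the signed permutations of \<open>pm n\<close>
  to the group of signs.\<close>

lemma prod_sgn_compose:
  assumes f: "f \<in> FI_BC n n" and g: "g \<in> FI_BC n n"
  shows "(\<Prod>a = 1..int n. sgn (compose (pm n) g f a)) =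
    (\<Prod>a = 1..int n. sgn (f a)) * (\<Prod>a = 1..int n. sgn (g a))"
proof -
  \<comment> \<open>Oddness of \<open>g\<close> pulls the sign of \<open>f a\<close> out of
    \<open>g (f a)\<close>; what remains is evaluated at a positive argument.\<close>
  have "sgn (compose (pm n) g f a) = sgn (f a) * sgn (g \<bar>f a\<bar>)" if "a \<in> {1..int n}" for a
    using that in_pm_if_in_Icc[OF that] FI_BC_abs_arg[OF g, of "f a"] FI_BC_maps[OF f, of a]
      FI_BC_nonzero[OF f, of a]
    by (auto simp: compose_def sgn_mult)
  then have "(\<Prod>a = 1..int n. sgn (compose (pm n) g f a)) =
      (\<Prod>a = 1..int n. sgn (f a)) * (\<Prod>a = 1..int n. sgn (g \<bar>f a\<bar>))"
    by (simp add: prod.distrib)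
  \<comment> \<open>The absolute values of \<open>f\<close> permute \<open>{1..int n}\<close>, so
    they only reorder the factors.\<close>
  also have "(\<Prod>a = 1..int n. sgn (g \<bar>f a\<bar>)) = (\<Prod>a = 1..int n. sgn (g a))"
    by (rule prod.reindex_bij_betw[OF FI_BC_abs_bij[OF f]])
  finally show ?thesis .
qed

lemma FI_category_D: "FI_category FI_D"
proof
  show "FI_D \<le> FI_BC" by (rule FI_D_le_FI_BC)
  show "(\<lambda>a\<in>pm n. a) \<in> FI_D n n" for n
    using FI_A_le_FI_D FI_category.id_mem[OF FI_category_A] by (fastforce simp: le_fun_def)
  fix l m n f g assume f: "f \<in> FI_D l m" and g: "g \<in> FI_D m n"
  have BC: "f \<in> FI_BC l m" "g \<in> FI_BC m n"
    using f g by (auto simp: FI_D_def)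
  \<comment> \<open>If the composite is an endomorphism, then \<open>m\<close> is squeezed between
    \<open>l\<close> and \<open>n\<close>, so both factors are endomorphisms and their sign products
    are known to be 1.\<close>
  have "m = n" if "l = n"
    using that FI_BC_le[OF BC(1)] FI_BC_le[OF BC(2)] by auto
  then show "compose (pm l) g f \<in> FI_D l n"
    using BC f g FI_category.compose_mem[OF FI_category_BC BC] prod_sgn_compose[of f l g]
    by (auto simp: FI_D_iff_prod_sgn)
qed

section \<open>Restriction along a subcategory\<close>

text \<open>The \<open>W'\<close>-morphism \<open>h\<close> is applied first, so that it moves a
  generator and \<open>g\<close> does the rest inside \<open>W\<close>. The bound on
  \<open>e\<close> is uniform in \<open>n\<close>, which leaves only finitely many \<open>h\<close>
  for each \<open>d\<close>.\<close>

definition factors_through :: "nat \<Rightarrow> hom_sets \<Rightarrow> hom_sets \<Rightarrow> bool" where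
  "factors_through r W W' \<longleftrightarrow>
     (\<forall>d n. \<forall>f\<in>W' d n. \<exists>e\<le>d + r. \<exists>h\<in>W' d e. \<exists>g\<in>W e n. f = compose (pm d) g h)"

lemma Res_simps [simp]:
  "obj (Res W V) = obj V"
  "f \<in> W m n \<Longrightarrow> mor (Res W V) m n f = mor V m n f"
  by (simp_all add: Res_def)

lemma FI_module_Res:
  assumes W: "FI_category W" and le: "W \<le> W'" and V: "FI_module W' R V"
  shows "FI_module W R (Res W V)"
proof -
  have sub: "f \<in> W m n \<Longrightarrow> f \<in> W' m n" for f m n
    using le by (auto simp: le_fun_def)
  show ?thesis
    unfolding FI_module_def
    using V FI_category.id_mem[OF W] FI_category.compose_mem[OF W]
    by (auto simp: FI_module_def sub)
qed

lemma FI_module_compose: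
  assumes "FI_module W R V" "f \<in> W l m" "g \<in> W m n" "x \<in> carrier (obj V l)"
  shows "mor V l n (compose (pm l) g f) x = mor V m n g (mor V l m f x)"
  using assms by (simp add: FI_module_def)

lemma FI_module_closed:
  assumes "FI_module W R V" "f \<in> W m n" "x \<in> carrier (obj V m)"
  shows "mor V m n f x \<in> carrier (obj V n)"
proof -
  have "mor V m n f \<in> linear_maps R (obj V m) (obj V n)"
    using assms(1,2) by (simp add: FI_module_def)
  then show ?thesis
    using assms(3) by (auto simp: linear_maps_def hom_def)
qed

text \<open>\<open>U\<close> need only be a submodule in each degree. An intersection of preimages
  of submodules under linear maps is a submodule, and letting \<open>f\<close> range over all
  \<open>W'\<close>-morphisms makes the family stable under \<open>W'\<close>.\<close>

lemma sub_FI_module_largest: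
  assumes W': "FI_category W'" and V: "FI_module W' R V" and U: "\<And>n. submodule (U n) R (obj V n)"
  shows "sub_FI_module W' R V
    (\<lambda>n. {x \<in> carrier (obj V n). \<forall>p. \<forall>f\<in>W' n p. mor V n p f x \<in> U p})"
    (is "sub_FI_module _ _ _ ?U'")
proof -
  have mods: "module R (obj V n)" for n
    using V by (simp add: FI_module_def)
  have lin: "mor V m n f \<in> linear_maps R (obj V m) (obj V n)" if "f \<in> W' m n" for m n f
    using V that by (simp add: FI_module_def)
  note comp = FI_module_compose[OF V] and carr = FI_module_closed[OF V]
  have "submodule (?U' n) R (obj V n)" for n
  proof -
    interpret M: module R "obj V n" by (rule mods)
    have hom: "group_hom (add_monoid (obj V n)) (add_monoid (obj V p)) (mor V n p f)"
      if "f \<in> W' n p" for p f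
      using lin[OF that] mods[of n] mods[of p]
      by (auto simp: linear_maps_def group_hom_def group_hom_axioms_def
          intro: abelian_group.a_group module.axioms)
    show ?thesis
    proof (intro submodule.intro subgroup.intro submodule_axioms.intro)
      show "\<one>\<^bsub>add_monoid (obj V n)\<^esub> \<in> ?U' n"
        using group_hom.hom_one[OF hom] subgroup.one_closed[OF submodule.axioms(1)[OF U]] by auto
      show "x \<otimes>\<^bsub>add_monoid (obj V n)\<^esub> y \<in> ?U' n" if "x \<in> ?U' n" "y \<in> ?U' n" for x y
        using that group_hom.hom_mult[OF hom] subgroup.m_closed[OF submodule.axioms(1)[OF U]]
        by auto
      show "inv\<^bsub>add_monoid (obj V n)\<^esub> x \<in> ?U' n" if "x \<in> ?U' n" for x
        using that group_hom.hom_inv[OF hom] subgroup.m_inv_closed[OF submodule.axioms(1)[OF U]]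
          group.inv_closed[OF M.a_group]
        by auto
      show "c \<odot>\<^bsub>obj V n\<^esub> x \<in> ?U' n" if "c \<in> carrier R" "x \<in> ?U' n" for c x
        using that lin submodule.smult_closed[OF U]
        by (auto simp: linear_maps_def)
    qed auto
  qed
  \<comment> \<open>Applying a further morphism to the image of \<open>x\<close> under
    \<open>f\<close> is applying a composite to \<open>x\<close>, and that lands in
    \<open>U\<close>.\<close>
  moreover have "mor V m n f ` ?U' m \<subseteq> ?U' n" if "f \<in> W' m n" for m n f
    using carr[OF that] FI_category.compose_mem[OF W' that] by (auto simp: comp[OF that, symmetric])
  ultimately show ?thesis
    by (simp add: sub_FI_module_def)
qed

lemma finitely_generated_in_degree_Res:
  assumes W: "FI_category W" and W': "FI_category W'" and le: "W \<le> W'"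
    and fac: "factors_through r W W'"
    and fg: "finitely_generated_in_degree W' R V m"
  shows "finitely_generated_in_degree W R (Res W V) (m + r)"
proof -
  from fg obtain S where V: "FI_module W' R V" and fin: "finite S"
    and deg: "\<And>d v. (d, v) \<in> S \<Longrightarrow> d \<le> m" and gen: "generates W' R V S"
    by (auto simp: finitely_generated_in_degree_def)
  have S_carr: "v \<in> carrier (obj V d)" if "(d, v) \<in> S" for d v
    using gen that by (auto simp: generates_def)
  note comp = FI_module_compose[OF V] and carr = FI_module_closed[OF V]
  \<comment> \<open>Finite, since \<open>S\<close>, the range of \<open>e\<close> and each Hom-set
    are finite.\<close>
  define S' where
    "S' = (\<Union>(d, v)\<in>S. \<Union>e\<in>{..d + r}. (\<lambda>h. (e, mor V d e h v)) ` W' d e)"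
  have "finite S'"
    unfolding S'_def using fin FI_category.finite_hom[OF W'] by auto
  moreover have "\<forall>(e, w)\<in>S'. e \<le> m + r"
    using deg by (fastforce simp: S'_def)
  moreover have "generates W R (Res W V) S'"
    unfolding generates_def
  proof (intro conjI allI impI)
    show "\<forall>(e, w)\<in>S'. w \<in> carrier (obj (Res W V) e)"
      using carr S_carr by (auto simp: S'_def)
    fix U n assume sub: "sub_FI_module W R (Res W V) U" and S'U: "\<forall>(e, w)\<in>S'. w \<in> U e"
    have subm: "submodule (U p) R (obj V p)" for p
      using sub by (simp add: sub_FI_module_def)
    have U_mor: "mor V p q g x \<in> U q" if "g \<in> W p q" "x \<in> U p" for p q g x
      using sub that by (auto simp: sub_FI_module_def image_subset_iff)
    define U' where "U' = (\<lambda>n. {x \<in> carrier (obj V n). \<forall>p. \<forall>f\<in>W' n p. mor V n p f x \<in> U p})"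
    \<comment> \<open>Every image of \<open>v\<close> under \<open>W'\<close> must lie in
      \<open>U\<close>. Factoring the morphism, \<open>h\<close> sends \<open>v\<close> into
      \<open>S'\<close>, hence into \<open>U\<close>, and \<open>g\<close> preserves
      \<open>U\<close>.\<close>
    have "v \<in> U' d" if dv: "(d, v) \<in> S" for d v
    proof -
      have "mor V d p f v \<in> U p" if f_mem: "f \<in> W' d p" for p f
      proof -
        obtain e h g where e: "e \<le> d + r" and h: "h \<in> W' d e" and g: "g \<in> W e p"
          and f: "f = compose (pm d) g h"
          using fac[unfolded factors_through_def, rule_format, OF f_mem] by blast
        have "(e, mor V d e h v) \<in> S'"
          using dv e h by (force simp: S'_def)
        then have "mor V e p g (mor V d e h v) \<in> U p"
          using S'U g U_mor by fastforce
        moreover have "g \<in> W' e p"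
          using g le by (auto simp: le_fun_def)
        ultimately show ?thesis
          using comp[OF h _ S_carr[OF dv]] f by simp
      qed
      then show ?thesis
        using S_carr[OF dv] by (simp add: U'_def)
    qed
    then have "U' n = carrier (obj V n)"
      using gen sub_FI_module_largest[OF W' V subm] unfolding generates_def U'_def by blast
    moreover have "mor V n n (\<lambda>a\<in>pm n. a) x = x" if "x \<in> carrier (obj V n)" for x
      using V that by (simp add: FI_module_def)
    \<comment> \<open>Taking the identity as \<open>f\<close> in the definition of \<open>U'\<close>
      shows that \<open>U' n\<close> is contained in \<open>U n\<close>.\<close>
    ultimately have "x \<in> U n" if "x \<in> carrier (obj V n)" for x
      using that FI_category.id_mem[OF W', of n] unfolding U'_def by (metis (lifting) CollectD)
    then show "U n = carrier (obj (Res W V) n)"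
      using subgroup.subset[OF submodule.axioms(1)[OF subm[of n]]] by auto
  qed
  ultimately show ?thesis
    using FI_module_Res[OF W le V] unfolding finitely_generated_in_degree_def by blast
qed

text \<open>A finite set of generators has bounded degrees, so the unqualified claim reduces to the
  one with degrees.\<close>

lemma finitely_generated_iff_in_degree:
  "finitely_generated W R V \<longleftrightarrow> (\<exists>m. finitely_generated_in_degree W R V m)"
proof
  assume "finitely_generated W R V"
  then obtain S where "FI_module W R V" "finite S" "generates W R V S"
    by (auto simp: finitely_generated_def)
  moreover obtain m where "\<forall>d\<in>fst ` S. d \<le> m"
    using finite_nat_set_iff_bounded_le[of "fst ` S"] \<open>finite S\<close> by auto
  ultimately show "\<exists>m. finitely_generated_in_degree W R V m"
    unfolding finitely_generated_in_degree_def by force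
qed (auto simp: finitely_generated_def finitely_generated_in_degree_def)

section \<open>Splitting off signs\<close>

lemma factors_through_refl:
  assumes "FI_category W"
  shows "factors_through 0 W W"
proof -
  have "f = compose (pm d) f (\<lambda>a\<in>pm d. a)" if "f \<in> W d n" for f d n
  proof
    show "f a = compose (pm d) f (\<lambda>a\<in>pm d. a) a" for a
      using FI_category.mem_FI_BC[OF assms that] by (auto simp: compose_def FI_BC_def PiE_iff extensional_def)
  qed
  then show ?thesis
    unfolding factors_through_def using FI_category.id_mem[OF assms] by fastforce
qed

text \<open>This multiplies \<open>a\<close> by the sign of \<open>f\<close> at the absolute value
  of \<open>a\<close>, when \<open>f\<close> is a signed injection. No codomain is fixed, so the
  same function serves as a morphism from \<open>d\<close> to any \<open>e \<ge> d\<close>.\<close>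

definition sign_part :: "nat \<Rightarrow> (int \<Rightarrow> int) \<Rightarrow> int \<Rightarrow> int" where
  "sign_part d f = (\<lambda>a\<in>pm d. sgn (f a) * \<bar>a\<bar>)"

lemma sign_part_FI_BC:
  assumes f: "f \<in> FI_BC d n" and "d \<le> e"
  shows "sign_part d f \<in> FI_BC d e"
proof -
  have maps: "sgn (f a) * \<bar>a\<bar> \<in> pm e" if "a \<in> pm d" for a
    using FI_BC_nonzero[OF f that] that pm_mono[OF \<open>d \<le> e\<close>]
    by (auto simp: sgn_if)
  have "inj_on (sign_part d f) (pm d)"
  proof (rule inj_onI)
    fix a b assume a: "a \<in> pm d" and b: "b \<in> pm d" and "sign_part d f a = sign_part d f b"
    then have eq: "sgn (f a) * \<bar>a\<bar> = sgn (f b) * \<bar>b\<bar>"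
      by (simp add: sign_part_def)
    have nz: "f a \<noteq> 0" "f b \<noteq> 0" "a \<noteq> 0" "b \<noteq> 0"
      using FI_BC_nonzero[OF f] a b by (auto simp: pm_def)
    \<comment> \<open>The common value determines both absolute value and sign; the absolute value
      fixes that of \<open>f\<close>, and together they fix \<open>f a\<close>.\<close>
    then have abs: "\<bar>a\<bar> = \<bar>b\<bar>" and "sgn (f a) = sgn (f b)"
      using eq by (auto simp: sgn_if split: if_splits)
    moreover have "\<bar>f a\<bar> = \<bar>f b\<bar>"
      using FI_BC_abs_eq_iff[OF f a b] abs by simp
    ultimately have "f a = f b"
      by (metis sgn_mult_abs)
    then show "a = b"
      using FI_BC_eq_iff[OF f a b] by simp
  qed
  then show ?thesis
    using maps FI_BC_odd[OF f] by (auto simp: FI_BC_def sign_part_def)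
qed

text \<open>By oddness \<open>g\<close> carries the sign of \<open>f a\<close> through, giving this
  sign times the absolute value of \<open>f a\<close>. Beyond \<open>d\<close> the values of
  \<open>g\<close> are free, which leaves room for \<open>e = d + 1\<close>.\<close>

lemma compose_sign_part:
  assumes f: "f \<in> FI_BC d n" and g: "g \<in> FI_BC e n" and "d \<le> e"
    and g_eq: "\<And>a. a \<in> {1..int d} \<Longrightarrow> g a = \<bar>f a\<bar>"
  shows "f = compose (pm d) g (sign_part d f)"
proof
  fix a
  show "f a = compose (pm d) g (sign_part d f) a"
  proof (cases "a \<in> pm d")
    case True
    then have "\<bar>a\<bar> \<in> pm e"
      using pm_mono[OF \<open>d \<le> e\<close>] by auto
    moreover have "g \<bar>a\<bar> = \<bar>f a\<bar>"
      using g_eq[OF abs_in_Icc_if_in_pm[OF True]] FI_BC_abs_eq_iff[OF f, of "\<bar>a\<bar>" a] True by simp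
    ultimately have "g (sgn (f a) * \<bar>a\<bar>) = f a"
      using FI_BC_odd[OF g, of "\<bar>a\<bar>"] FI_BC_nonzero[OF f True] by (auto simp: sgn_if)
    then show ?thesis
      using True by (simp add: compose_def sign_part_def)
  next
    case False
    then show ?thesis
      using f by (auto simp: compose_def FI_BC_def PiE_iff extensional_def)
  qed
qed

text \<open>Morphisms of \<open>FI_A\<close> are ordinary injections in disguise: the values on
  positive arguments determine the rest by oddness.\<close>

lemma odd_extension_FI_A:
  assumes inj: "inj_on p {1..int d}" and maps: "p ` {1..int d} \<subseteq> {1..int n}"
  shows "(\<lambda>a\<in>pm d. sgn a * p \<bar>a\<bar>) \<in> FI_A d n"
proof -
  have p: "1 \<le> p \<bar>a\<bar> \<and> p \<bar>a\<bar> \<le> int n" if "a \<in> pm d" for a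
    using maps abs_in_Icc_if_in_pm[OF that] by (auto simp: image_subset_iff)
  have nz: "a \<noteq> 0" if "a \<in> pm d" for a
    using that by (simp add: pm_def)
  have "inj_on (\<lambda>a. sgn a * p \<bar>a\<bar>) (pm d)"
  proof (rule inj_onI)
    fix a b assume a: "a \<in> pm d" and b: "b \<in> pm d" and eq: "sgn a * p \<bar>a\<bar> = sgn b * p \<bar>b\<bar>"
    then have "p \<bar>a\<bar> = p \<bar>b\<bar>" "sgn a = sgn b"
      using p[OF a] p[OF b] nz by (auto simp: sgn_if split: if_splits)
    then show "a = b"
      using inj_onD[OF inj] abs_in_Icc_if_in_pm a b by (metis sgn_mult_abs)
  qed
  moreover have "sgn a * p \<bar>a\<bar> \<in> pm n" "sgn (sgn a * p \<bar>a\<bar>) = sgn a" if "a \<in> pm d" for a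
    using p[OF that] nz[OF that] by (auto simp: pm_def sgn_if abs_mult)
  ultimately show ?thesis
    by (auto simp: FI_A_def FI_BC_def cong: inj_on_cong)
qed

lemma FI_BC_factor:
  assumes f: "f \<in> FI_BC d n"
  obtains g where "g \<in> FI_A d n" "f = compose (pm d) g (sign_part d f)"
proof -
  define g where "g = (\<lambda>a\<in>pm d. sgn a * \<bar>f \<bar>a\<bar>\<bar>)"
  have g: "g \<in> FI_A d n"
    unfolding g_def by (rule odd_extension_FI_A[OF FI_BC_abs_inj[OF f] FI_BC_abs_image[OF f]])
  moreover have "g a = \<bar>f a\<bar>" if "a \<in> {1..int d}" for a
    using that in_pm_if_in_Icc[OF that] by (simp add: g_def)
  ultimately show ?thesis
    using that compose_sign_part[OF f FI_category.mem_FI_BC[OF FI_category_A g]] by blast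
qed

text \<open>The same sign change is now read as a map from \<open>d\<close> to \<open>d + 1\<close>,
  where it is no endomorphism. The positive part must be extended injectively to the extra point,
  which takes a free value in the target.\<close>

lemma FI_BC_factor_Suc:
  assumes f: "f \<in> FI_BC d n" and "d < n"
  obtains g where "g \<in> FI_A (Suc d) n" "f = compose (pm d) g (sign_part d f)"
proof -
  \<comment> \<open>The absolute values of \<open>f\<close> take only \<open>d < n\<close> values;
    \<open>c\<close> is one that is missed, and \<open>d + 1\<close> is sent to it.\<close>
  have "card ((\<lambda>a. \<bar>f a\<bar>) ` {1..int d}) < card {1..int n}"
    using card_image[OF FI_BC_abs_inj[OF f]] \<open>d < n\<close> by simp
  then obtain c where c: "c \<in> {1..int n}" "c \<notin> (\<lambda>a. \<bar>f a\<bar>) ` {1..int d}"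
    using FI_BC_abs_image[OF f] by (metis less_irrefl subsetI subset_antisym)
  define p where "p a = (if a \<le> int d then \<bar>f a\<bar> else c)" for a
  have split: "{1..int (Suc d)} = insert (int (Suc d)) {1..int d}"
    by auto
  have img: "p ` {1..int d} = (\<lambda>a. \<bar>f a\<bar>) ` {1..int d}"
    by (auto simp: p_def image_iff)
  have "inj_on p {1..int d}"
    using FI_BC_abs_inj[OF f] by (auto simp: inj_on_def p_def)
  then have "inj_on p {1..int (Suc d)}"
    using c(2) img unfolding split by (auto simp: p_def)
  moreover have "p ` {1..int (Suc d)} \<subseteq> {1..int n}"
    using c(1) FI_BC_abs_image[OF f] unfolding split image_insert img by (simp add: p_def)
  ultimately have g: "(\<lambda>a\<in>pm (Suc d). sgn a * p \<bar>a\<bar>) \<in> FI_A (Suc d) n" (is "?g \<in> _")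
    by (rule odd_extension_FI_A)
  have "?g a = \<bar>f a\<bar>" if "a \<in> {1..int d}" for a
    using that by (simp add: p_def pm_def)
  then have "f = compose (pm d) ?g (sign_part d f)"
    by (rule compose_sign_part[OF f FI_category.mem_FI_BC[OF FI_category_A g] le_SucI[OF order_refl]])
  with g show ?thesis
    by (rule that)
qed

lemma factors_through_mono: "factors_through r W\<^sub>1 W' \<Longrightarrow> W\<^sub>1 \<le> W\<^sub>2 \<Longrightarrow> factors_through r W\<^sub>2 W'"
  unfolding factors_through_def by (meson le_funD subsetD)

section \<open>Factorizations for the proper inclusions\<close>

lemma factors_through_FI_A_BC: "factors_through 0 FI_A FI_BC"
  unfolding factors_through_def
proof (intro allI ballI)
  fix d n f assume f: "f \<in> FI_BC d n"
  obtain g where "g \<in> FI_A d n" "f = compose (pm d) g (sign_part d f)"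
    using FI_BC_factor[OF f] .
  then show "\<exists>e\<le>d + 0. \<exists>h\<in>FI_BC d e. \<exists>g\<in>FI_A e n. f = compose (pm d) g h"
    using sign_part_FI_BC[OF f order_refl] by auto
qed

lemma factors_through_FI_D_BC: "factors_through 0 FI_D FI_BC"
  using factors_through_FI_A_BC FI_A_le_FI_D by (rule factors_through_mono)

lemma factors_through_FI_A_D: "factors_through 1 FI_A FI_D"
  unfolding factors_through_def
proof (intro allI ballI)
  fix d n f assume "f \<in> FI_D d n"
  then have f: "f \<in> FI_BC d n" and sgn: "d = n \<Longrightarrow> (\<Prod>a = 1..int d. sgn (f a)) = 1"
    by (auto simp: FI_D_iff_prod_sgn)
  show "\<exists>e\<le>d + 1. \<exists>h\<in>FI_D d e. \<exists>g\<in>FI_A e n. f = compose (pm d) g h"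
  proof (cases "d = n")
    case True
    have "sgn (sign_part d f a) = sgn (f a)" if "a \<in> {1..int d}" for a
      using that in_pm_if_in_Icc[OF that] by (simp add: sign_part_def sgn_mult)
    \<comment> \<open>Here \<open>f\<close> and its sign part have the same sign product, which is
      1.\<close>
    then have "sign_part d f \<in> FI_D d d"
      using sign_part_FI_BC[OF f order_refl] sgn[OF True] by (simp add: FI_D_iff_prod_sgn)
    moreover obtain g where "g \<in> FI_A d n" "f = compose (pm d) g (sign_part d f)"
      using FI_BC_factor[OF f] .
    ultimately show ?thesis
      by (intro exI[of _ d]) auto
  next
    case False
    then have "d < n"
      using FI_BC_le[OF f] by simp
    then obtain g where "g \<in> FI_A (Suc d) n" "f = compose (pm d) g (sign_part d f)"
      using FI_BC_factor_Suc[OF f] by blast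
    \<comment> \<open>Source and target differ, so any number of reversed signs is allowed; this is
      what raises the degree by one.\<close>
    moreover have "sign_part d f \<in> FI_D d (Suc d)"
      using sign_part_FI_BC[OF f, of "Suc d"] by (simp add: FI_D_iff_prod_sgn)
    ultimately show ?thesis
      by (intro exI[of _ "Suc d"]) auto
  qed
qed

theorem proposition3p22:
  fixes k :: "('a, 'r) ring_scheme" and V :: "('a, 'b) functor_data"
  assumes "cring k"
  shows
    "(\<forall>W \<in> {FI_A, FI_D, FI_BC}. \<forall>W' \<in> {FI_A, FI_D, FI_BC}. W \<le> W' \<longrightarrow>
        finitely_generated W' k V \<longrightarrow> finitely_generated W k (Res W V)) \<and>
     (\<forall>m. finitely_generated_in_degree FI_BC k V m \<longrightarrow>
        finitely_generated_in_degree FI_A k (Res FI_A V) m) \<and>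
     (\<forall>m. finitely_generated_in_degree FI_BC k V m \<longrightarrow>
        finitely_generated_in_degree FI_D k (Res FI_D V) m) \<and>
     (\<forall>m. finitely_generated_in_degree FI_D k V m \<longrightarrow>
        finitely_generated_in_degree FI_A k (Res FI_A V) (m + 1))"
proof -
  note cats = FI_category_A FI_category_D FI_category_BC
  have A_BC: "FI_A \<le> FI_BC"
    using FI_A_le_FI_D FI_D_le_FI_BC by (rule order_trans)
  have "\<exists>r. factors_through r W W'"
    if "W \<in> {FI_A, FI_D, FI_BC}" "W' \<in> {FI_A, FI_D, FI_BC}" "W \<le> W'" for W W'
  proof -
    \<comment> \<open>An inclusion against the chain becomes an equality by antisymmetry, so three
      proper pairs remain.\<close>
    have "W = W' \<or> (W, W') \<in> {(FI_A, FI_D), (FI_A, FI_BC), (FI_D, FI_BC)}"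
      using that FI_A_le_FI_D FI_D_le_FI_BC A_BC by (auto intro: antisym)
    then show ?thesis
      using factors_through_refl[OF cats(1)] factors_through_refl[OF cats(2)]
        factors_through_refl[OF cats(3)] factors_through_FI_A_BC factors_through_FI_D_BC
        factors_through_FI_A_D that(1)
      by blast
  qed
  moreover have "FI_category W" if "W \<in> {FI_A, FI_D, FI_BC}" for W
    using that cats by auto
  ultimately have "finitely_generated W k (Res W V)"
    if "W \<in> {FI_A, FI_D, FI_BC}" "W' \<in> {FI_A, FI_D, FI_BC}" "W \<le> W'" "finitely_generated W' k V"
    for W W'
    using that finitely_generated_in_degree_Res unfolding finitely_generated_iff_in_degree by metis
  moreover note
    finitely_generated_in_degree_Res[OF cats(1,3) A_BC factors_through_FI_A_BC, of k V]
    finitely_generated_in_degree_Res[OF cats(2,3) FI_D_le_FI_BC factors_through_FI_D_BC, of k V]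
    finitely_generated_in_degree_Res[OF cats(1,2) FI_A_le_FI_D factors_through_FI_A_D, of k V]
  ultimately show ?thesis
    by simp
qed

end
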